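(* Let $n\ge 1$ be an integer, $V=[n]=\{1,\dots,n\}$, and let $S=(s_{ij})_{i,j\in V}$ be a symmetric real matrix with $s_{ij}\ge 0$ and $s_{ii}=0$ for all $i,j\in V$. For $\lambda\in[0,\tfrac12]$, define $F:2^V\to\mathbb{R}$ by $$F(A)=\sum_{i\in A}\sum_{j\in V}s_{ij}-\lambda\sum_{i\in A}\sum_{j\in A}s_{ij},\qquad A\subseteq V.$$ Then $F$ is entropic.
   Context: A set function $f:2^{[n]}\to\mathbb{R}_{\ge 0}$ is called entropic if there exist jointly distributed (discrete) random variables $X_1,\dots,X_n$ such that $f(A)=H(X_A)$ for all $A\subseteq[n]$, where $X_A=(X_i)_{i\in A}$ and $H$ denotes (joint) Shannon entropy, with $H(X_\emptyset)=0$. *)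

theory Defs
  imports "HOL-Probability.Probability"
begin

text \<open>
  For discrete \<open>X\<^sub>1, \<dots>, X\<^sub>n\<close> on some probability space, \<open>joint_var X A\<close> is \<open>X\<^sub>A = (X\<^sub>i)\<^sub>i\<^sub>\<in>\<^sub>A\<close>, an extensional
  function on \<open>A\<close>. Values are coded as natural numbers.
\<close>

definition joint_var :: "(nat \<Rightarrow> 's \<Rightarrow> nat) \<Rightarrow> nat set \<Rightarrow> 's \<Rightarrow> nat \<Rightarrow> nat"
  where "joint_var X A = (\<lambda>\<omega>. \<lambda>i\<in>A. X i \<omega>)"

abbreviation joint_space :: "nat set \<Rightarrow> (nat \<Rightarrow> nat) measure"
  where "joint_space A \<equiv> count_space (A \<rightarrow>\<^sub>E UNIV)"

text \<open>
  A discrete random variable takes countably many values, so \<open>nat\<close>-valued variables lose no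
  generality; nor does the sample space type \<open>nat \<Rightarrow> nat\<close>, since the joint law of
  \<open>X\<^sub>1, \<dots>, X\<^sub>n\<close> lives on it. Infinite alphabets are allowed, and \<open>entropy\<close> is a Bochner integral,
  which is \<open>0\<close> for a non-integrable integrand. The \<open>finite_entropy\<close> clause (with \<open>p\<close> the mass
  function of \<open>X\<^sub>A\<close>) therefore requires that \<open>H(X\<^sub>A)\<close> is really finite. The parameter \<open>b\<close> is the base
  of the logarithm; \<open>information_space M b\<close> says that \<open>M\<close> is a probability space and \<open>1 < b\<close>.
\<close>

definition entropic :: "real \<Rightarrow> nat \<Rightarrow> (nat set \<Rightarrow> real) \<Rightarrow> bool"
  where "entropic b n f \<longleftrightarrow>
    (\<forall>A \<subseteq> {1..n}. 0 \<le> f A) \<and>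
    (\<exists>(M :: (nat \<Rightarrow> nat) measure) (X :: nat \<Rightarrow> (nat \<Rightarrow> nat) \<Rightarrow> nat).
      information_space M b \<and>
      (\<forall>i \<in> {1..n}. X i \<in> measurable M (count_space UNIV)) \<and>
      (\<forall>A \<subseteq> {1..n}.
        (\<exists>p. information_space.finite_entropy M b (joint_space A) (joint_var X A) p) \<and>
        f A = prob_space.entropy M b (joint_space A) (joint_var X A)))"

end

theory Submission
  imports Defs "HOL-Real_Asymp.Real_Asymp"
begin

text \<open>
  The weight \<open>s i j\<close> of a pair is split into a part \<open>2 * lam * s i j\<close> of randomness shared by
  \<open>i\<close> and \<open>j\<close> and a private part \<open>(1 - 2 * lam) * s i j\<close> for each of them. Taking independent
  finitely supported variables with these entropies, and letting \<open>X i\<close> collect all variables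
  that \<open>i\<close> sees, the entropy of \<open>X\<^sub>A\<close> is the sum of the entropies of the variables seen by \<open>A\<close>;
  a shared variable with both ends in \<open>A\<close> is counted once instead of twice, which is the
  subtracted term of \<open>F\<close>.
\<close>

section \<open>Entropy of finitely supported distributions\<close>

definition pmf_entropy :: "real \<Rightarrow> 'a pmf \<Rightarrow> real"
  where "pmf_entropy b p = - (\<Sum>x\<in>set_pmf p. pmf p x * log b (pmf p x))"

lemma pmf_entropy_superset:
  assumes "finite S" "set_pmf p \<subseteq> S"
  shows "pmf_entropy b p = - (\<Sum>x\<in>S. pmf p x * log b (pmf p x))"
  unfolding pmf_entropy_def
  using assms by (auto intro!: sum.mono_neutral_left simp: set_pmf_iff)

lemma pmf_entropy_return [simp]: "pmf_entropy b (return_pmf x) = 0"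
  by (simp add: pmf_entropy_def)

lemma pmf_entropy_map_inj:
  assumes "inj_on f (set_pmf p)"
  shows "pmf_entropy b (map_pmf f p) = pmf_entropy b p"
  unfolding pmf_entropy_def
  by (simp add: sum.reindex[OF assms] pmf_map_inj[OF assms] cong: sum.cong)

lemma pmf_entropy_pair:
  assumes p: "finite (set_pmf p)" and q: "finite (set_pmf q)"
  shows "pmf_entropy b (pair_pmf p q) = pmf_entropy b p + pmf_entropy b q"
proof -
  have "(\<Sum>z\<in>set_pmf p \<times> set_pmf q. pmf (pair_pmf p q) z * log b (pmf (pair_pmf p q) z))
      = (\<Sum>x\<in>set_pmf p. \<Sum>y\<in>set_pmf q. pmf p x * pmf q y * log b (pmf p x * pmf q y))"
    by (auto simp: sum.cartesian_product pmf_pair intro!: sum.cong)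
  \<comment> \<open>Both sums run over supports, so the masses are positive and the logarithm of the
    product splits.\<close>
  also have "\<dots> = (\<Sum>x\<in>set_pmf p. \<Sum>y\<in>set_pmf q.
      pmf p x * log b (pmf p x) * pmf q y + pmf p x * (pmf q y * log b (pmf q y)))"
    by (intro sum.cong refl) (simp add: log_mult_pos pmf_positive algebra_simps)
  also have "\<dots> = (\<Sum>x\<in>set_pmf p. pmf p x * log b (pmf p x)) * (\<Sum>y\<in>set_pmf q. pmf q y)
      + (\<Sum>x\<in>set_pmf p. pmf p x) * (\<Sum>y\<in>set_pmf q. pmf q y * log b (pmf q y))"
    by (simp add: sum.distrib sum_product)
  finally show ?thesis
    using sum_pmf_eq_1[OF p subset_refl] sum_pmf_eq_1[OF q subset_refl]
    by (simp add: pmf_entropy_def)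
qed

lemma finite_set_Pi_pmf:
  assumes "finite K" "\<And>k. k \<in> K \<Longrightarrow> finite (set_pmf (q k))"
  shows "finite (set_pmf (Pi_pmf K d q))"
  by (rule finite_subset[OF set_Pi_pmf_subset' finite_PiE_dflt]) (use assms in auto)

lemma pmf_entropy_Pi_pmf:
  assumes "finite K" "\<And>k. k \<in> K \<Longrightarrow> finite (set_pmf (q k))"
  shows "pmf_entropy b (Pi_pmf K d q) = (\<Sum>k\<in>K. pmf_entropy b (q k))"
  using assms
proof (induction K rule: finite_induct)
  case (insert k K)
  \<comment> \<open>Functions in the support of \<open>Pi_pmf K d q\<close> have the value
    \<open>d\<close> at \<open>k\<close>, so the update at \<open>k\<close> destroys no
    information.\<close>
  have "inj_on (\<lambda>(y, f). f(k := y)) (set_pmf (pair_pmf (q k) (Pi_pmf K d q)))"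
  proof (rule inj_onI, clarsimp)
    fix y f y' f'
    assume *: "f \<in> set_pmf (Pi_pmf K d q)" "f' \<in> set_pmf (Pi_pmf K d q)" and eq: "f(k := y) = f'(k := y')"
    then have "f k = d" "f' k = d"
      using set_Pi_pmf_subset'[OF insert.hyps(1), of d q] insert.hyps(2)
      by (auto simp: PiE_dflt_def)
    with eq show "y = y' \<and> f = f'"
      by (metis fun_upd_eqD fun_upd_triv fun_upd_upd)
  qed
  then show ?case
    using insert
    by (simp add: Pi_pmf_insert pmf_entropy_map_inj pmf_entropy_pair finite_set_Pi_pmf)
qed auto

text \<open>Bridge to the entropy of the library. \<open>S\<close> may be infinite: only the
  finitely many points of positive mass contribute.\<close>

lemma
  assumes b: "1 < b" and fin: "finite (set_pmf p)" and Y: "\<And>\<omega>. Y \<omega> \<in> S"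
  shows finite_entropy_measure_pmf:
      "information_space.finite_entropy (measure_pmf p) b (count_space S) Y (pmf (map_pmf Y p))"
    and entropy_measure_pmf:
      "prob_space.entropy (measure_pmf p) b (count_space S) Y = pmf_entropy b (map_pmf Y p)"
proof -
  interpret information_space "measure_pmf p" b
    using b by unfold_locales
  let ?f = "pmf (map_pmf Y p)"
  have meas: "Y \<in> measurable (measure_pmf p) (count_space S)"
    using Y by auto
  have D: "distributed (measure_pmf p) (count_space S) Y ?f"
    unfolding distributed_def
  proof (intro conjI measure_eqI)
    fix B assume "B \<in> sets (distr (measure_pmf p) (count_space S) Y)"
    then have B: "B \<subseteq> S" by simp
    have "emeasure (density (count_space S) ?f) B
        = (\<integral>\<^sup>+x. ennreal (?f x) * indicator B x \<partial>count_space S)"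
      using B by (simp add: emeasure_density)
    also have "\<dots> = (\<integral>\<^sup>+x. ?f x \<partial>count_space B)"
      using B by (simp add: nn_integral_count_space_indicator mult.assoc)
         (auto intro!: nn_integral_cong simp: indicator_def)
    also have "\<dots> = emeasure (distr (measure_pmf p) (count_space S) Y) B"
      using B meas by (simp add: nn_integral_pmf emeasure_distr)
    finally show "emeasure (distr (measure_pmf p) (count_space S) Y) B
        = emeasure (density (count_space S) ?f) B" ..
  qed (use meas in auto)
  have finY: "finite (set_pmf (map_pmf Y p))" "set_pmf (map_pmf Y p) \<subseteq> S"
    using fin Y by auto
  let ?g = "\<lambda>x. ?f x * log b (?f x)"
  \<comment> \<open>Off the support the factor \<open>?f x\<close> is 0, so the value of
    \<open>log b 0\<close> is irrelevant.\<close>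
  have supp: "?g x = 0" if "x \<notin> set_pmf (map_pmf Y p)" for x
    using that by (simp add: set_pmf_iff del: set_map_pmf)
  have "Infinite_Set_Sum.abs_summable_on ?g (set_pmf (map_pmf Y p))"
    using finY by (intro abs_summable_on_finite)
  then have "Infinite_Set_Sum.abs_summable_on ?g S"
    using finY supp by (subst abs_summable_on_cong_neutral[of _ "set_pmf (map_pmf Y p)" ?g ?g]) auto
  then show "finite_entropy (count_space S) Y ?f"
    using D unfolding finite_entropy_def abs_summable_on_def by auto
  have "{x \<in> S. ?g x \<noteq> 0} \<subseteq> set_pmf (map_pmf Y p)"
    using supp by blast
  then have "(\<integral>x. ?g x \<partial>count_space S) = (\<Sum>x\<in>set_pmf (map_pmf Y p). ?g x)"
    using finY by (subst lebesgue_integral_count_space_finite_support)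
      (auto intro: finite_subset intro!: sum.mono_neutral_left simp del: set_map_pmf)
  then show "prob_space.entropy (measure_pmf p) b (count_space S) Y = pmf_entropy b (map_pmf Y p)"
    by (simp add: entropy_distr[OF D] pmf_entropy_def del: set_map_pmf)
qed

text \<open>The hypothesis on \<open>Y\<close> says that \<open>Y\<close> carries exactly the
  information of the coordinates in \<open>L\<close>, so its entropy is that of the marginal on
  \<open>L\<close>.\<close>

lemma pmf_entropy_map_Pi_pmf:
  assumes K: "finite K" "L \<subseteq> K" and fin: "\<And>k. k \<in> K \<Longrightarrow> finite (set_pmf (q k))"
    and Y: "\<And>\<omega> \<omega>'. Y \<omega> = Y \<omega>' \<longleftrightarrow> (\<forall>k\<in>L. \<omega> k = \<omega>' k)"
  shows "pmf_entropy b (map_pmf Y (Pi_pmf K d q)) = (\<Sum>k\<in>L. pmf_entropy b (q k))"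
proof -
  have L: "finite L" using K finite_subset by blast
  \<comment> \<open>The marginal on \<open>L\<close> arises by resetting all other coordinates to
    \<open>d\<close>, which \<open>Y\<close> cannot see.\<close>
  have "map_pmf Y (Pi_pmf L d q) = map_pmf (\<lambda>\<omega>. Y (\<lambda>k. if k \<in> L then \<omega> k else d)) (Pi_pmf K d q)"
    using K by (simp add: Pi_pmf_subset[of K L] map_pmf_comp)
  also have "\<dots> = map_pmf Y (Pi_pmf K d q)"
    by (intro map_pmf_cong refl) (simp add: Y)
  finally have "map_pmf Y (Pi_pmf K d q) = map_pmf Y (Pi_pmf L d q)" ..
  moreover have "inj_on Y (set_pmf (Pi_pmf L d q))"
  proof (rule inj_onI)
    fix \<omega> \<omega>' assume "\<omega> \<in> set_pmf (Pi_pmf L d q)" "\<omega>' \<in> set_pmf (Pi_pmf L d q)" "Y \<omega> = Y \<omega>'"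
    then show "\<omega> = \<omega>'"
      using set_Pi_pmf_subset'[OF L, of d q] Y[of \<omega> \<omega>']
      by (auto simp: PiE_dflt_def fun_eq_iff subset_iff) metis
  qed
  ultimately show ?thesis
    using L K fin by (simp add: pmf_entropy_map_inj pmf_entropy_Pi_pmf subset_iff)
qed

section \<open>Distributions with prescribed entropy\<close>

lemma continuous_on_xlogx: "continuous_on {0..} (\<lambda>x::real. x * ln x)"
proof (subst continuous_on_eq_continuous_within, intro ballI)
  fix x :: real assume "x \<in> {0..}"
  show "continuous (at x within {0..}) (\<lambda>x. x * ln x)"
  proof (cases "x = 0")
    case True
    have "((\<lambda>x::real. x * ln x) \<longlongrightarrow> 0) (at_right 0)"
      by real_asymp
    then show ?thesis
      using True by (simp add: continuous_within at_within_Ici_at_right)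
  next
    case False
    then show ?thesis
      by (rule continuous_at_imp_continuous_at_within[OF isCont_mult[OF continuous_ident isCont_ln]])
  qed
qed

text \<open>Intermediate value theorem for the binary entropy function, which is 0 at 0 and
  \<open>log b 2\<close> at 1/2.\<close>

lemma exists_bool_pmf_entropy:
  assumes b: "1 < b" and h: "0 \<le> h" "h \<le> log b 2"
  shows "\<exists>p::bool pmf. pmf_entropy b p = h"
proof -
  let ?H = "\<lambda>t::real. - (t * ln t + (1 - t) * ln (1 - t)) / ln b"
  have "continuous_on {0..1/2} ?H"
    by (intro continuous_intros continuous_on_compose2[OF continuous_on_xlogx]
        continuous_on_compose2[OF continuous_on_xlogx, of _ "\<lambda>t. 1 - t"]) (use b in auto)
  moreover have "?H 0 \<le> h" "h \<le> ?H (1/2)"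
    using h b by (auto simp: log_def ln_div)
  ultimately obtain t where t: "0 \<le> t" "t \<le> 1/2" "?H t = h"
    using IVT'[of ?H 0 h "1/2"] by auto
  have "pmf_entropy b (bernoulli_pmf t) = ?H t"
    using t by (subst pmf_entropy_superset[of UNIV])
      (auto simp: UNIV_bool log_def add_divide_distrib diff_divide_distrib)
  with t(3) show ?thesis by (intro exI[of _ "bernoulli_pmf t"]) simp
qed

text \<open>One bit has entropy at most \<open>log b 2\<close>, so \<open>h\<close> is spread evenly
  over \<open>m\<close> independent bits, coded together as one number.\<close>

lemma exists_nat_pmf_entropy:
  assumes b: "1 < b" and h: "0 \<le> h"
  shows "\<exists>p::nat pmf. finite (set_pmf p) \<and> pmf_entropy b p = h"
proof -
  obtain m where "h / log b 2 \<le> real m"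
    using real_arch_simple by blast
  moreover have "0 < log b 2"
    using b by simp
  ultimately have m: "h \<le> real m * log b 2"
    by (simp add: field_simps)
  show ?thesis
  proof (cases "m = 0")
    case True
    with m h have "h = 0" by simp
    then show ?thesis by (intro exI[of _ "return_pmf 0"]) auto
  next
    case False
    with m h obtain p :: "bool pmf" where p: "pmf_entropy b p = h / real m"
      using exists_bool_pmf_entropy[OF b, of "h / real m"] by (auto simp: field_simps)
    let ?P = "Pi_pmf {..<m} False (\<lambda>_. p)"
    let ?Y = "\<lambda>\<omega>. to_nat (map \<omega> [0..<m])"
    have "pmf_entropy b (map_pmf ?Y ?P) = h"
      using False p by (subst pmf_entropy_map_Pi_pmf[where L = "{..<m}"]) auto
    moreover have "finite (set_pmf (map_pmf ?Y ?P))"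
      by (auto intro!: finite_set_Pi_pmf)
    ultimately show ?thesis by blast
  qed
qed

section \<open>Weighted coverage functions, and \<open>F\<close> as one of them\<close>

lemma entropic_coverage:
  fixes K :: "nat set" and B :: "nat \<Rightarrow> nat set" and h :: "nat \<Rightarrow> real"
  assumes b: "1 < b" and K: "finite K" "\<And>i. i \<in> {1..n} \<Longrightarrow> B i \<subseteq> K"
    and h: "\<And>k. k \<in> K \<Longrightarrow> 0 \<le> h k"
    and f: "\<And>A. A \<subseteq> {1..n} \<Longrightarrow> f A = (\<Sum>k\<in>(\<Union>i\<in>A. B i). h k)"
  shows "entropic b n f"
proof -
  obtain q :: "nat \<Rightarrow> nat pmf"
    where q: "\<And>k. k \<in> K \<Longrightarrow> finite (set_pmf (q k))" "\<And>k. k \<in> K \<Longrightarrow> pmf_entropy b (q k) = h k"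
    using exists_nat_pmf_entropy[OF b h] by metis
  \<comment> \<open>A sample point is the whole family of independent sources, one of entropy
    \<open>h k\<close> for each \<open>k\<close> in \<open>K\<close>.\<close>
  define P where "P = Pi_pmf K 0 q"
  \<comment> \<open>Codes the restriction of the sample point to \<open>B i\<close> as one number;
    this is faithful because \<open>B i\<close> is finite.\<close>
  define X where "X i \<omega> = to_nat (map \<omega> (sorted_list_of_set (B i)))" for i and \<omega> :: "nat \<Rightarrow> nat"
  have finP: "finite (set_pmf P)"
    unfolding P_def using K q by (intro finite_set_Pi_pmf)
  have X_eq: "X i \<omega> = X i \<omega>' \<longleftrightarrow> (\<forall>k\<in>B i. \<omega> k = \<omega>' k)" if "i \<in> {1..n}" for i \<omega> \<omega>'
    using finite_subset[OF K(2)[OF that] K(1)] by (simp add: X_def)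
  have entropy_X: "pmf_entropy b (map_pmf (joint_var X A) P) = f A" if A: "A \<subseteq> {1..n}" for A
  proof -
    have "joint_var X A \<omega> = joint_var X A \<omega>' \<longleftrightarrow> (\<forall>k\<in>(\<Union>i\<in>A. B i). \<omega> k = \<omega>' k)" for \<omega> \<omega>'
    proof -
      have "joint_var X A \<omega> = joint_var X A \<omega>' \<longleftrightarrow> (\<forall>i\<in>A. X i \<omega> = X i \<omega>')"
        by (auto simp: joint_var_def fun_eq_iff restrict_def)
      also have "\<dots> \<longleftrightarrow> (\<forall>i\<in>A. \<forall>k\<in>B i. \<omega> k = \<omega>' k)"
        using A by (intro ball_cong refl X_eq) blast
      finally show ?thesis by blast
    qed
    moreover have "(\<Union>i\<in>A. B i) \<subseteq> K"
      using A K(2) by blast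
    ultimately show ?thesis
      unfolding P_def f[OF A] using K(1) q
      by (subst pmf_entropy_map_Pi_pmf[where L = "\<Union>i\<in>A. B i"]) (auto intro!: sum.cong)
  qed
  have range: "joint_var X A \<omega> \<in> A \<rightarrow>\<^sub>E UNIV" for A \<omega>
    by (simp add: joint_var_def)
  have "0 \<le> f A" if "A \<subseteq> {1..n}" for A
    unfolding f[OF that] using that K(2) h by (intro sum_nonneg) blast
  moreover have "information_space (measure_pmf P) b"
    using b by unfold_locales
  moreover have "information_space.finite_entropy (measure_pmf P) b (joint_space A) (joint_var X A)
      (pmf (map_pmf (joint_var X A) P))" for A
    by (rule finite_entropy_measure_pmf[OF b finP range])
  moreover have "f A = prob_space.entropy (measure_pmf P) b (joint_space A) (joint_var X A)" if "A \<subseteq> {1..n}" for A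
    using entropy_X[OF that] entropy_measure_pmf[OF b finP range[of A]] by simp
  ultimately show ?thesis
    unfolding entropic_def
    by (intro conjI exI[of _ "measure_pmf P"] exI[of _ X]) auto
qed

theorem theorem6:
  fixes n :: nat and s :: "nat \<Rightarrow> nat \<Rightarrow> real" and lam b :: real and F :: "nat set \<Rightarrow> real"
  assumes "1 \<le> n"
    and "\<And>i j. i \<in> {1..n} \<Longrightarrow> j \<in> {1..n} \<Longrightarrow> s i j = s j i"
    and "\<And>i j. i \<in> {1..n} \<Longrightarrow> j \<in> {1..n} \<Longrightarrow> 0 \<le> s i j"
    and "\<And>i. i \<in> {1..n} \<Longrightarrow> s i i = 0"
    and "0 \<le> lam" and "lam \<le> 1 / 2"
    and "\<And>A. A \<subseteq> {1..n} \<Longrightarrow>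
      F A = (\<Sum>i\<in>A. \<Sum>j\<in>{1..n}. s i j) - lam * (\<Sum>i\<in>A. \<Sum>j\<in>A. s i j)"
    and "1 < b"
  shows "entropic b n F"
proof -
  define V where "V = {1..n}"
  \<comment> \<open>Ordered pairs: \<open>(i, j)\<close> and \<open>(j, i)\<close> each carry half of the shared entropy; \<open>(i, i)\<close> carries
      all the private entropy of \<open>i\<close>.\<close>
  define w where "w i j = lam * s i j + (if i = j then (1 - 2 * lam) * (\<Sum>l\<in>V. s i l) else 0)" for i j
  \<comment> \<open>The sources seen by \<open>A\<close>: member \<open>i\<close> sees every ordered
    pair that has \<open>i\<close> as an end.\<close>
  define E where "E A = {(i, j) \<in> V \<times> V. i \<in> A \<or> j \<in> A}" for A
  have finV: "finite V" by (simp add: V_def)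
  \<comment> \<open>\<open>lam <= 1/2\<close> enters here: it makes the private weight
    nonnegative.\<close>
  have w_nonneg: "0 \<le> w i j" if "i \<in> V" "j \<in> V" for i j
    unfolding w_def using that assms(3,5,6)
    by (intro add_nonneg_nonneg mult_nonneg_nonneg) (auto simp: V_def intro!: mult_nonneg_nonneg sum_nonneg)
  have sum_E: "(\<Sum>(i, j)\<in>E A. w i j) = F A" if A: "A \<subseteq> V" for A
  proof -
    have finA: "finite A" using A finV finite_subset by blast
    \<comment> \<open>Disjoint split by whether the first end lies in \<open>A\<close>. The second
      piece contains no diagonal pair, hence no private weight.\<close>
    have "E A = A \<times> V \<union> (V - A) \<times> A"
      using A by (auto simp: E_def)
    then have "(\<Sum>(i, j)\<in>E A. w i j) = (\<Sum>i\<in>A. \<Sum>j\<in>V. w i j) + (\<Sum>i\<in>V - A. \<Sum>j\<in>A. w i j)"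
      using finA finV by (simp add: sum.union_disjoint sum.cartesian_product Times_Int_Times)
    also have "(\<Sum>i\<in>A. \<Sum>j\<in>V. w i j)
        = lam * (\<Sum>i\<in>A. \<Sum>j\<in>V. s i j) + (1 - 2 * lam) * (\<Sum>i\<in>A. \<Sum>j\<in>V. s i j)"
      using A finV by (auto simp: w_def sum.distrib sum_distrib_left intro!: sum.cong)
    also have "(\<Sum>i\<in>V - A. \<Sum>j\<in>A. w i j) = lam * (\<Sum>i\<in>V - A. \<Sum>j\<in>A. s i j)"
      by (auto simp: w_def sum_distrib_left intro!: sum.cong)
    also have "(\<Sum>i\<in>V - A. \<Sum>j\<in>A. s i j) = (\<Sum>i\<in>V. \<Sum>j\<in>A. s i j) - (\<Sum>i\<in>A. \<Sum>j\<in>A. s i j)"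
      using sum_diff[OF finV A, of "\<lambda>i. \<Sum>j\<in>A. s i j"] .
    \<comment> \<open>By symmetry of \<open>s\<close>. With R this sum and Q the sum over
      \<open>A\<close> in both indices, the total is lam R + (1 - 2 lam) R + lam (R - Q) = R - lam
      Q.\<close>
    also have "(\<Sum>i\<in>V. \<Sum>j\<in>A. s i j) = (\<Sum>i\<in>A. \<Sum>j\<in>V. s i j)"
      by (subst sum.swap) (use A assms(2) in \<open>auto simp: V_def intro!: sum.cong\<close>)
    finally show ?thesis
      using assms(7)[of A] A by (simp add: V_def algebra_simps)
  qed
  show ?thesis
  \<comment> \<open>\<open>prod_encode\<close> numbers the pairs, since sources are indexed by
    natural numbers.\<close>
  proof (rule entropic_coverage[where K = "prod_encode ` (V \<times> V)" and B = "\<lambda>i. prod_encode ` E {i}"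
        and h = "\<lambda>k. case prod_decode k of (i, j) \<Rightarrow> w i j"])
    fix A assume A: "A \<subseteq> {1..n}"
    have "(\<Union>i\<in>A. prod_encode ` E {i}) = prod_encode ` E A"
      by (auto simp: E_def)
    then show "F A = (\<Sum>k\<in>(\<Union>i\<in>A. prod_encode ` E {i}). case prod_decode k of (i, j) \<Rightarrow> w i j)"
      using A sum_E[of A] by (simp add: sum.reindex inj_prod_encode V_def)
  qed (use assms(8) finV w_nonneg in \<open>auto simp: E_def\<close>)
qed

end
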